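(* For any finite family of objects $A_1,\dots,A_n$ ($n\ge0$) in a cartesian multicategory $\mathcal M$, the following are equivalent: 1. $A_1,\dots,A_n$ has an algebraic product. 2. $A_1,\dots,A_n$ has a universal product. 3. $A_1,\dots,A_n$ is the domain of a preuniversal arrow.
   Context: A cartesian structure on a multicategory $\mathcal M$ assigns, to every mapping $\sigma:\{1,\dots,n\}\to\{1,\dots,m\}$ and sequences of objects $A_1,\dots,A_n$ and $B_1,\dots,B_m$ with $B_{\sigma i}=A_i$, and every object $C$, a mapping $f\mapsto\sigma f$, $\mathcal M(A_1,\dots,A_n;C)\to\mathcal M(B_1,\dots,B_m;C)$, functorially ($\mathrm{id}f=f$, $\rho(\sigma f)=(\rho\sigma)f$) and compatibly with composition: (i) $f(\sigma_1f_1,\dots,\sigma_nf_n)=(\sigma_1+\cdots+\sigma_n)f(f_1,\dots,f_n)$, where $+$ is juxtaposition of mappings; (ii) $(\sigma f)(f_1,\dots,f_m)=\sigma'\big(f(f_{\sigma1},\dots,f_{\sigma n})\big)$, where $\sigma'$ maps the $k$-th place of the $i$-th block (the domain of $f_{\sigma i}$) to the $k$-th place of the $(\sigma i)$-th block of the concatenated domains of $f_1,\dots,f_m$. A cartesian multicategory is a multicategory with a cartesian structure. An algebraic product of $A_1,\dots,A_n$ is an object $C$ with arrows $p_i:C\to A_i$ ($1\le i\le n$) and $u:A_1,\dots,A_n\to C$ such that $\gamma\big(u(p_1,\dots,p_n)\big)=\mathrm{id}_C$, where $\gamma:\mathcal M(C,\dots,C;C)\to\mathcal M(C;C)$ is the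 action of the unique map $\{1,\dots,n\}\to\{1\}$, and $p_i\,u=\iota_i\,\mathrm{id}_{A_i}$ for each $i$, where $\iota_i:\mathcal M(A_i;A_i)\to\mathcal M(A_1,\dots,A_n;A_i)$ is the action of the map $\{1\}\to\{1,\dots,n\}$, $1\mapsto i$. A universal product of $A_1,\dots,A_n$ is an object $C$ with arrows $p_i:C\to A_i$ such that for every sequence $X_1,\dots,X_k$ ($k\geq 0$) and arrows $f_i:X_1,\dots,X_k\to A_i$ ($1\le i\le n$) there is a unique $t:X_1,\dots,X_k\to C$ with $p_it=f_i$ for all $i$. An arrow $u:A_1,\dots,A_n\to C$ is preuniversal if composition with $u$ gives a bijection $\mathcal M(C;B)\to\mathcal M(A_1,\dots,A_n;B)$ for every object $B$. *)

theory Defs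
  imports Main
begin

section \<open>Multicategories\<close>

text \<open>
  Arrows carry their domain (a finite, possibly empty, sequence of objects) and their codomain, so
  that hom-sets are disjoint.  Throughout, places in a sequence are numbered from \<open>0\<close>, and
  \<open>mcomp M f [f\<^sub>1, \<dots>, f\<^sub>n]\<close> is the composite written \<open>f(f\<^sub>1, \<dots>, f\<^sub>n)\<close>.
\<close>

record ('o, 'a) multicategory =
  mobj :: "'o set"
  marr :: "'a set"
  mdom :: "'a \<Rightarrow> 'o list"
  mcod :: "'a \<Rightarrow> 'o"
  mid :: "'o \<Rightarrow> 'a"
  mcomp :: "'a \<Rightarrow> 'a list \<Rightarrow> 'a"

definition mhom :: "('o, 'a, 'z) multicategory_scheme \<Rightarrow> 'o list \<Rightarrow> 'o \<Rightarrow> 'a set" where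
  "mhom M As B = {f \<in> marr M. mdom M f = As \<and> mcod M f = B}"

definition composable :: "('o, 'a, 'z) multicategory_scheme \<Rightarrow> 'a \<Rightarrow> 'a list \<Rightarrow> bool" where
  "composable M f fs \<longleftrightarrow> f \<in> marr M \<and> set fs \<subseteq> marr M \<and> map (mcod M) fs = mdom M f"

locale multicategory =
  fixes M :: "('o, 'a, 'z) multicategory_scheme" (structure)
  assumes dom_obj: "f \<in> marr M \<Longrightarrow> set (mdom M f) \<subseteq> mobj M"
    and cod_obj: "f \<in> marr M \<Longrightarrow> mcod M f \<in> mobj M"
    and id_hom: "A \<in> mobj M \<Longrightarrow> mid M A \<in> mhom M [A] A"
    and comp_hom:
      "composable M f fs \<Longrightarrow> mcomp M f fs \<in> mhom M (concat (map (mdom M) fs)) (mcod M f)"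
    and comp_id_left: "f \<in> marr M \<Longrightarrow> mcomp M (mid M (mcod M f)) [f] = f"
    and comp_id_right: "f \<in> marr M \<Longrightarrow> mcomp M f (map (mid M) (mdom M f)) = f"
    and comp_assoc:
      "\<lbrakk>composable M f fs; list_all2 (composable M) fs gss\<rbrakk>
       \<Longrightarrow> mcomp M (mcomp M f fs) (concat gss) = mcomp M f (map2 (mcomp M) fs gss)"


section \<open>Cartesian structures\<close>

text \<open>
  A mapping \<open>\<sigma> : {0..<n} \<rightarrow> {0..<m}\<close> is encoded as the list of its values: a list of length \<open>n\<close> with
  entries below \<open>m\<close>, so \<open>\<sigma> ! i\<close> is the value at \<open>i\<close>.  In particular \<open>[0..<n]\<close> is the identity and
  \<open>map ((!) \<rho>) \<sigma>\<close> is the composite \<open>\<rho>\<sigma>\<close>.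
\<close>

definition reindexing :: "nat list \<Rightarrow> 'o list \<Rightarrow> 'o list \<Rightarrow> bool" where
  "reindexing \<sigma> As Bs \<longleftrightarrow>
     length \<sigma> = length As \<and> (\<forall>i < length As. \<sigma> ! i < length Bs \<and> Bs ! (\<sigma> ! i) = As ! i)"

text \<open>
  When consecutive blocks have lengths \<open>ms\<close>, the \<open>k\<close>-th place of the \<open>j\<close>-th block is the
  \<open>block_place ms j k\<close>-th place of the concatenation.
\<close>

definition block_place :: "nat list \<Rightarrow> nat \<Rightarrow> nat \<Rightarrow> nat" where
  "block_place ms j k = sum_list (take j ms) + k"

text \<open>
  The juxtaposition \<open>\<sigma>\<^sub>1 + \<dots> + \<sigma>\<^sub>n\<close>.  The sizes \<open>ms\<close> of the codomains must be supplied, since the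
  \<open>\<sigma>\<^sub>i\<close> need not be surjective.
\<close>

definition juxtaposition :: "nat list \<Rightarrow> nat list list \<Rightarrow> nat list" where
  "juxtaposition ms \<sigma>s =
     concat (map (\<lambda>i. map (block_place ms i) (\<sigma>s ! i)) [0..<length \<sigma>s])"

text \<open>
  The mapping \<open>\<sigma>'\<close>: with \<open>ms\<close> the lengths of the domains of \<open>f\<^sub>1, \<dots>, f\<^sub>m\<close>, the \<open>k\<close>-th place of the
  \<open>i\<close>-th block (which has length \<open>ms ! (\<sigma> ! i)\<close>) goes to the \<open>k\<close>-th place of the \<open>(\<sigma> i)\<close>-th block.
\<close>

definition block_map :: "nat list \<Rightarrow> nat list \<Rightarrow> nat list" where
  "block_map ms \<sigma> = concat (map (\<lambda>j. map (block_place ms j) [0..<ms ! j]) \<sigma>)"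

text \<open>
  \<open>mact M Bs \<sigma> f\<close> is the arrow \<open>\<sigma>f\<close> with domain \<open>Bs\<close>; again \<open>Bs\<close> is not determined by \<open>\<sigma>\<close> and \<open>f\<close>.
\<close>

record ('o, 'a) cartesian_multicategory = "('o, 'a) multicategory" +
  mact :: "'o list \<Rightarrow> nat list \<Rightarrow> 'a \<Rightarrow> 'a"

locale cartesian_multicategory = multicategory M
  for M :: "('o, 'a, 'z) cartesian_multicategory_scheme" (structure) +
  assumes act_hom:
      "\<lbrakk>f \<in> marr M; set Bs \<subseteq> mobj M; reindexing \<sigma> (mdom M f) Bs\<rbrakk>
       \<Longrightarrow> mact M Bs \<sigma> f \<in> mhom M Bs (mcod M f)"
    and act_id: "f \<in> marr M \<Longrightarrow> mact M (mdom M f) [0..<length (mdom M f)] f = f"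
    and act_act:
      "\<lbrakk>f \<in> marr M; set Bs \<subseteq> mobj M; set Cs \<subseteq> mobj M;
        reindexing \<sigma> (mdom M f) Bs; reindexing \<rho> Bs Cs\<rbrakk>
       \<Longrightarrow> mact M Cs \<rho> (mact M Bs \<sigma> f) = mact M Cs (map ((!) \<rho>) \<sigma>) f"
    and comp_act_right:
      "\<lbrakk>composable M f fs; length \<sigma>s = length fs; length Bss = length fs;
        \<And>i. i < length fs \<Longrightarrow> set (Bss ! i) \<subseteq> mobj M;
        \<And>i. i < length fs \<Longrightarrow> reindexing (\<sigma>s ! i) (mdom M (fs ! i)) (Bss ! i)\<rbrakk>
       \<Longrightarrow> mcomp M f (map (\<lambda>i. mact M (Bss ! i) (\<sigma>s ! i) (fs ! i)) [0..<length fs]) =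
           mact M (concat Bss) (juxtaposition (map length Bss) \<sigma>s) (mcomp M f fs)"
    and comp_act_left:
      "\<lbrakk>f \<in> marr M; set fs \<subseteq> marr M; reindexing \<sigma> (mdom M f) (map (mcod M) fs)\<rbrakk>
       \<Longrightarrow> mcomp M (mact M (map (mcod M) fs) \<sigma> f) fs =
           mact M (concat (map (mdom M) fs)) (block_map (map (\<lambda>g. length (mdom M g)) fs) \<sigma>)
             (mcomp M f (map ((!) fs) \<sigma>))"


section \<open>Products and preuniversal arrows\<close>

definition projections ::
    "('o, 'a, 'z) multicategory_scheme \<Rightarrow> 'o list \<Rightarrow> 'o \<Rightarrow> 'a list \<Rightarrow> bool" where
  "projections M As C ps \<longleftrightarrow>
     length ps = length As \<and> (\<forall>i < length As. ps ! i \<in> mhom M [C] (As ! i))"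

definition algebraic_product ::
    "('o, 'a, 'z) cartesian_multicategory_scheme \<Rightarrow> 'o list \<Rightarrow> 'o \<Rightarrow> 'a list \<Rightarrow> 'a \<Rightarrow> bool" where
  "algebraic_product M As C ps u \<longleftrightarrow>
     C \<in> mobj M \<and> projections M As C ps \<and> u \<in> mhom M As C \<and>
     mact M [C] (replicate (length As) 0) (mcomp M u ps) = mid M C \<and>
     (\<forall>i < length As. mcomp M (ps ! i) [u] = mact M As [i] (mid M (As ! i)))"

definition universal_product ::
    "('o, 'a, 'z) multicategory_scheme \<Rightarrow> 'o list \<Rightarrow> 'o \<Rightarrow> 'a list \<Rightarrow> bool" where
  "universal_product M As C ps \<longleftrightarrow>
     C \<in> mobj M \<and> projections M As C ps \<and>
     (\<forall>Xs fs. set Xs \<subseteq> mobj M \<and> length fs = length As \<and>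
        (\<forall>i < length As. fs ! i \<in> mhom M Xs (As ! i)) \<longrightarrow>
        (\<exists>!t. t \<in> mhom M Xs C \<and> (\<forall>i < length As. mcomp M (ps ! i) [t] = fs ! i)))"

definition preuniversal :: "('o, 'a, 'z) multicategory_scheme \<Rightarrow> 'a \<Rightarrow> bool" where
  "preuniversal M u \<longleftrightarrow>
     u \<in> marr M \<and>
     (\<forall>B \<in> mobj M.
        bij_betw (\<lambda>f. mcomp M f [u]) (mhom M [mcod M u] B) (mhom M (mdom M u) B))"

end

theory Submission imports Defs begin

text \<open>
  Suppose \<open>p\<^sub>i u = \<iota>\<^sub>i id\<close> for all \<open>i\<close>.  Then the contraction \<open>t\<close> of \<open>u(f\<^sub>1, \<dots>, f\<^sub>n)\<close> along the
  codiagonal satisfies \<open>p\<^sub>i t = f\<^sub>i\<close>, and every \<open>g\<close> with the domain of \<open>u\<close> equals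
  \<open>(\<gamma>(g(p\<^sub>1, \<dots>, p\<^sub>n))) u\<close>.  The remaining equation \<open>\<gamma>(u(p\<^sub>1, \<dots>, p\<^sub>n)) = id\<close> of an algebraic product
  makes \<open>t\<close> and \<open>\<gamma>(g(p\<^sub>1, \<dots>, p\<^sub>n))\<close> unique; conversely, the uniqueness clauses of universal
  products and of preuniversal arrows force this equation.
\<close>

section \<open>Codiagonal mappings\<close>

text \<open>The fold of \<open>n\<close> consecutive copies of a block of length \<open>k\<close>
  onto one copy. The width \<open>k\<close> is arbitrary because \<open>n\<close> arrows with a
  common domain \<open>Xs\<close> are merged over all of \<open>Xs\<close>. For \<open>n = 0\<close>
  the mapping is empty and its action only adds dummy places.\<close>

definition codiagonal :: "nat \<Rightarrow> nat \<Rightarrow> nat list" where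
  "codiagonal n k = concat (replicate n [0..<k])"

lemma length_codiagonal [simp]: "length (codiagonal n k) = n * k"
  by (simp add: codiagonal_def length_concat sum_list_replicate)

lemma nth_concat_replicate:
  "l < n * length xs \<Longrightarrow> concat (replicate n xs) ! l = xs ! (l mod length xs)"
proof (induction n arbitrary: l)
  case (Suc n)
  show ?case
  proof (cases "l < length xs")
    case True
    then show ?thesis by (simp add: nth_append)
  next
    case False
    then have "concat (replicate n xs) ! (l - length xs) = xs ! ((l - length xs) mod length xs)"
      using Suc.prems by (intro Suc.IH) auto
    then show ?thesis using False by (simp add: nth_append le_mod_geq)
  qed
qed simp

lemma nth_codiagonal: "l < n * k \<Longrightarrow> codiagonal n k ! l = l mod k"
  using nth_concat_replicate[of l n "[0..<k]"]
  by (cases "k = 0") (auto simp: codiagonal_def)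

text \<open>Identifies the fold of width one with \<open>replicate n 0\<close>, the encoding of the
  map to one point through which \<gamma> acts.\<close>

lemma codiagonal_one: "codiagonal n 1 = replicate n 0"
  by (induction n) (auto simp: codiagonal_def)

lemma block_place_zero: "block_place ms 0 = (\<lambda>k. k)"
  by (simp add: fun_eq_iff block_place_def)

text \<open>Every block is sent to the only block there is, so \<sigma>' for the map to one point is
  a fold as wide as the domain of the substituted arrow.\<close>

lemma block_map_replicate_zero: "block_map [k] (replicate n 0) = codiagonal n k"
  by (simp add: block_map_def codiagonal_def block_place_zero)

lemma reindexing_codiagonal:
  "reindexing (codiagonal n (length Xs)) (concat (replicate n Xs)) Xs"
proof -
  have "l mod length Xs < length Xs" if "l < n * length Xs" for l
    using that by (cases "Xs = []") auto
  then show ?thesis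
    by (simp add: reindexing_def nth_codiagonal nth_concat_replicate length_concat
        sum_list_replicate)
qed

lemma block_index_less: "i * k + j < n * k" if "i < n" "j < k" for i j k n :: nat
proof -
  have "i * k + j < Suc i * k" using that by simp
  also have "\<dots> \<le> n * k" using that by (intro mult_le_mono1) simp
  finally show ?thesis .
qed

lemma block_place_replicate: "i < n \<Longrightarrow> block_place (replicate n k) i j = i * k + j"
  by (simp add: block_place_def sum_list_replicate)

lemma juxtaposition_singleton: "juxtaposition [m] [\<sigma>] = \<sigma>"
  by (simp add: juxtaposition_def block_place_zero)

text \<open>Including block \<open>i\<close> moves place \<open>j\<close> to
  \<open>i * k + j\<close>; the fold takes the remainder modulo \<open>k\<close>, which is
  \<open>j\<close> again.\<close>

lemma codiagonal_block:
  assumes "i < n"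
  shows "map ((!) (codiagonal n k)) (block_map (replicate n k) [i]) = [0..<k]"
proof (rule nth_equalityI)
  fix j assume "j < length (map ((!) (codiagonal n k)) (block_map (replicate n k) [i]))"
  then have "j < k" using assms by (simp add: block_map_def)
  then show "map ((!) (codiagonal n k)) (block_map (replicate n k) [i]) ! j = [0..<k] ! j"
    using assms
    by (simp add: block_map_def block_place_replicate nth_codiagonal block_index_less)
qed (use assms in \<open>simp add: block_map_def\<close>)

lemma reindexing_block:
  assumes "i < n"
  shows "reindexing (block_map (replicate n (length Xs)) [i]) Xs (concat (replicate n Xs))"
  using assms
  by (simp add: reindexing_def block_map_def block_place_replicate block_index_less
      length_concat sum_list_replicate nth_concat_replicate)

lemma juxtaposition_points:
  "juxtaposition (replicate n n) (map (\<lambda>i. [i]) [0..<n]) = map (\<lambda>i. i * n + i) [0..<n]"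
proof -
  have "juxtaposition (replicate n n) (map (\<lambda>i. [i]) [0..<n]) =
      concat (map (\<lambda>i. [i * n + i]) [0..<n])"
    unfolding juxtaposition_def
    by (rule arg_cong[of _ _ concat]) (simp add: block_place_replicate)
  then show ?thesis by simp
qed


section \<open>Arrows into and out of the base of a product\<close>

lemma mhomD:
  assumes "f \<in> mhom M As B"
  shows "f \<in> marr M" "mdom M f = As" "mcod M f = B"
  using assms by (auto simp: mhom_def)

section \<open>Composition with unary arrows and with projections\<close>

context multicategory
begin

lemma mcomp_mhom:
  assumes "f \<in> mhom M (map (mcod M) fs) B" "set fs \<subseteq> marr M"
  shows "mcomp M f fs \<in> mhom M (concat (map (mdom M) fs)) B"
  using comp_hom[of f fs] assms by (auto simp: composable_def mhom_def)

lemma mcomp_mhom_single: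
  assumes "f \<in> mhom M [B] C" "g \<in> mhom M As B"
  shows "mcomp M f [g] \<in> mhom M As C"
  using mcomp_mhom[of f "[g]" C] assms by (auto simp: mhom_def)

lemma mcomp_assoc_single:
  assumes "f \<in> mhom M [mcod M g] C" "g \<in> mhom M (map (mcod M) hs) B" "set hs \<subseteq> marr M"
  shows "mcomp M (mcomp M f [g]) hs = mcomp M f [mcomp M g hs]"
  using comp_assoc[of f "[g]" "[hs]"] assms by (auto simp: composable_def mhom_def)

text \<open>Associativity with a copy of \<open>g\<close> under each unary inner arrow: the blocks
  are the singletons \<open>[g]\<close>.\<close>

lemma mcomp_replicate:
  assumes "f \<in> mhom M (map (mcod M) fs) C" "\<forall>p \<in> set fs. p \<in> marr M \<and> mdom M p = [mcod M g]"
    and "g \<in> marr M"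
  shows "mcomp M (mcomp M f fs) (replicate (length fs) g) = mcomp M f (map (\<lambda>p. mcomp M p [g]) fs)"
proof -
  have "concat (replicate n [g]) = replicate n g" for n
    by (induction n) auto
  moreover have "map2 (mcomp M) fs (replicate (length fs) [g]) = map (\<lambda>p. mcomp M p [g]) fs"
    by (rule nth_equalityI) auto
  moreover have "list_all2 (composable M) fs (replicate (length fs) [g])"
    using assms by (auto simp: list_all2_conv_all_nth composable_def)
  moreover have "composable M f fs"
    using assms by (auto simp: composable_def mhom_def)
  ultimately show ?thesis using comp_assoc by metis
qed

lemma projectionsD:
  assumes "projections M As C ps"
  shows "length ps = length As" "map (mcod M) ps = As"
    "concat (map (mdom M) ps) = replicate (length As) C"
    "\<forall>p \<in> set ps. p \<in> marr M \<and> mdom M p = [C]"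
proof -
  show len: "length ps = length As" using assms by (simp add: projections_def)
  show "map (mcod M) ps = As"
    using assms by (auto simp: projections_def mhom_def intro: nth_equalityI)
  show all: "\<forall>p \<in> set ps. p \<in> marr M \<and> mdom M p = [C]"
    using assms by (auto simp: projections_def mhom_def in_set_conv_nth)
  have "concat (map (mdom M) xs) = replicate (length xs) C" if "\<forall>p \<in> set xs. mdom M p = [C]" for xs
    using that by (induction xs) auto
  then show "concat (map (mdom M) ps) = replicate (length As) C"
    using all len by metis
qed

end

section \<open>Contractions, injections and tupling\<close>

context cartesian_multicategory
begin

lemma mcomp_mact_single:
  assumes "f \<in> mhom M [mcod M g] C" "g \<in> marr M" "set Bs \<subseteq> mobj M"
    and "reindexing \<sigma> (mdom M g) Bs"
  shows "mcomp M f [mact M Bs \<sigma> g] = mact M Bs \<sigma> (mcomp M f [g])"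
  using comp_act_right[of f "[g]" "[\<sigma>]" "[Bs]"] assms
  by (auto simp: composable_def mhom_def juxtaposition_singleton)

text \<open>The \<open>\<gamma>\<close> of the informal definitions is the case \<open>Xs = [C]\<close>.\<close>

definition contract :: "'o list \<Rightarrow> nat \<Rightarrow> 'a \<Rightarrow> 'a" where
  "contract Xs n = mact M Xs (codiagonal n (length Xs))"

lemma contract_mhom:
  assumes "f \<in> mhom M (concat (replicate n Xs)) B" "set Xs \<subseteq> mobj M"
  shows "contract Xs n f \<in> mhom M Xs B"
  using act_hom[of f Xs "codiagonal n (length Xs)"] assms reindexing_codiagonal[of n Xs]
  by (auto simp: contract_def mhom_def)

lemma mcomp_contract:
  assumes "f \<in> mhom M [B] C" "g \<in> mhom M (concat (replicate n Xs)) B" "set Xs \<subseteq> mobj M"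
  shows "mcomp M f [contract Xs n g] = contract Xs n (mcomp M f [g])"
  unfolding contract_def
  by (rule mcomp_mact_single) (use assms reindexing_codiagonal[of n Xs] in \<open>auto simp: mhom_def\<close>)

text \<open>This is \<open>comp_act_left\<close> for the map to one point: the single inner arrow
  \<open>t\<close> is duplicated \<open>n\<close> times, and the resulting block map is the fold of
  width \<open>length Xs\<close>.\<close>

lemma contract_single_mcomp:
  assumes "g \<in> mhom M (replicate n C) B" "t \<in> mhom M Xs C"
  shows "mcomp M (contract [C] n g) [t] = contract Xs n (mcomp M g (replicate n t))"
proof -
  note g = mhomD[OF assms(1)] and t = mhomD[OF assms(2)]
  have "reindexing (replicate n 0) (mdom M g) (map (mcod M) [t])"
    by (simp add: reindexing_def g t)
  from comp_act_left[OF g(1) _ this]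
  have "mcomp M (mact M [C] (replicate n 0) g) [t] =
      mact M Xs (block_map [length Xs] (replicate n 0)) (mcomp M g (map ((!) [t]) (replicate n 0)))"
    by (simp add: t)
  then show ?thesis
    by (simp add: contract_def block_map_replicate_zero codiagonal_one[simplified])
qed

text \<open>The arrow \<iota>_i id in the definition of an algebraic product: it returns the
  \<open>i\<close>-th argument and discards the others.\<close>

definition injection :: "'o list \<Rightarrow> nat \<Rightarrow> 'a" where
  "injection As i = mact M As [i] (mid M (As ! i))"

lemma injection_mhom:
  assumes "set As \<subseteq> mobj M" "i < length As"
  shows "injection As i \<in> mhom M As (As ! i)"
proof -
  have "mid M (As ! i) \<in> mhom M [As ! i] (As ! i)" using assms by (intro id_hom) auto
  then show ?thesis
    using act_hom[of "mid M (As ! i)" As "[i]"] assms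
    by (auto simp: injection_def mhom_def reindexing_def)
qed

text \<open>By \<open>comp_act_left\<close>, substituting \<open>fs\<close> into the injection
  leaves \<open>fs ! i\<close>, acted on by the inclusion of block \<open>i\<close> into the copies
  of \<open>Xs\<close>; folding undoes this inclusion.\<close>

lemma contract_injection_mcomp:
  assumes As: "set As \<subseteq> mobj M" "i < length As" and Xs: "set Xs \<subseteq> mobj M"
    and len: "length fs = length As"
    and fs: "\<forall>j < length As. fs ! j \<in> mhom M Xs (As ! j)"
  shows "contract Xs (length As) (mcomp M (injection As i) fs) = fs ! i"
proof -
  let ?n = "length As"
  have cods: "map (mcod M) fs = As"
    using len fs by (auto simp: mhom_def intro: nth_equalityI)
  have doms: "map (mdom M) fs = replicate ?n Xs"
    using len fs by (auto simp: mhom_def intro: nth_equalityI)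
  have "length \<circ> mdom M = (\<lambda>g. length (mdom M g))" by auto
  then have lens: "map (\<lambda>g. length (mdom M g)) fs = replicate ?n (length Xs)"
    using arg_cong[OF doms, of "map length"] by simp
  have fs_arr: "set fs \<subseteq> marr M"
    using len fs by (auto simp: mhom_def in_set_conv_nth)
  note fi = mhomD[OF fs[rule_format, OF As(2)]]
  have A: "As ! i \<in> mobj M" using As by auto
  note idA = mhomD[OF id_hom[OF A]]
  have "reindexing [i] (mdom M (mid M (As ! i))) (map (mcod M) fs)"
    using As by (simp add: reindexing_def idA cods)
  from comp_act_left[OF idA(1) fs_arr this]
  have "mcomp M (injection As i) fs =
      mact M (concat (replicate ?n Xs)) (block_map (replicate ?n (length Xs)) [i]) (fs ! i)"
    using comp_id_left[OF fi(1)] by (simp add: injection_def cods doms lens fi)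
  moreover have "set (concat (replicate ?n Xs)) \<subseteq> mobj M" using Xs by auto
  ultimately show ?thesis
    using act_act[OF fi(1), of "concat (replicate ?n Xs)" Xs
        "block_map (replicate ?n (length Xs)) [i]" "codiagonal ?n (length Xs)"]
      Xs reindexing_block[OF As(2), of Xs] reindexing_codiagonal[of ?n Xs]
      codiagonal_block[OF As(2), of "length Xs"] act_id[OF fi(1)]
    by (simp add: contract_def fi)
qed

text \<open>With identities as inner arrows, \<open>comp_act_right\<close> collects the injections
  into one mapping acting on \<open>g\<close>, which sends \<open>i\<close> to place
  \<open>i\<close> of the \<open>i\<close>-th copy of \<open>As\<close>. As
  \<open>(i * n + i) mod n = i\<close> for \<open>n = length As\<close>, folding turns it into the
  identity.\<close>

lemma contract_mcomp_injections:
  assumes As: "set As \<subseteq> mobj M" and g: "g \<in> mhom M As B"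
  shows "contract As (length As) (mcomp M g (map (injection As) [0..<length As])) = g"
proof -
  let ?n = "length As"
  let ?ids = "map (mid M) As" and ?\<sigma> = "map (\<lambda>i. i * ?n + i) [0..<?n]"
  note g = mhomD[OF g]
  have ids: "mid M A \<in> marr M" "mdom M (mid M A) = [A]" "mcod M (mid M A) = A" if "A \<in> set As" for A
    using mhomD[OF id_hom[of A]] that As by auto
  have act: "mcomp M g (map (\<lambda>i. mact M (replicate ?n As ! i) (map (\<lambda>i. [i]) [0..<?n] ! i) (?ids ! i))
        [0..<length ?ids]) =
      mact M (concat (replicate ?n As))
        (juxtaposition (map length (replicate ?n As)) (map (\<lambda>i. [i]) [0..<?n])) (mcomp M g ?ids)"
    by (rule comp_act_right)
      (use As in \<open>auto simp: composable_def reindexing_def ids g intro: nth_equalityI\<close>)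
  have inj: "map (\<lambda>i. mact M (replicate ?n As ! i) (map (\<lambda>i. [i]) [0..<?n] ! i) (?ids ! i))
        [0..<length ?ids] = map (injection As) [0..<?n]"
    by (simp add: injection_def)
  have "mcomp M g ?ids = g"
    using comp_id_right[OF g(1)] by (simp add: g)
  then have "mcomp M g (map (injection As) [0..<?n]) =
      mact M (concat (replicate ?n As)) ?\<sigma> g"
    using act[unfolded inj] by (simp add: juxtaposition_points)
  moreover have "reindexing ?\<sigma> (mdom M g) (concat (replicate ?n As))"
    by (simp add: reindexing_def g block_index_less nth_concat_replicate length_concat
        sum_list_replicate)
  moreover have "map ((!) (codiagonal ?n ?n)) ?\<sigma> = [0..<?n]"
    by (rule nth_equalityI) (simp_all add: nth_codiagonal block_index_less)
  moreover have "set (concat (replicate ?n As)) \<subseteq> mobj M" using As by auto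
  ultimately show ?thesis
    using act_act[OF g(1) _ As, of "concat (replicate ?n As)" ?\<sigma> "codiagonal ?n ?n"]
      reindexing_codiagonal[of ?n As] act_id[OF g(1)]
    by (simp add: contract_def g)
qed

text \<open>Contraction commutes with composing \<open>ps ! i\<close> on the outside, associativity
  brings \<open>ps ! i\<close> next to \<open>u\<close>, and the resulting injection selects
  \<open>fs ! i\<close>. This is the existence of tuples.\<close>

lemma mcomp_contract_section:
  assumes Xs: "set Xs \<subseteq> mobj M" and As: "set As \<subseteq> mobj M"
    and ps: "projections M As C ps" and u: "u \<in> mhom M As C"
    and pu: "\<forall>i < length As. mcomp M (ps ! i) [u] = injection As i"
    and len: "length fs = length As"
    and fs: "\<forall>j < length As. fs ! j \<in> mhom M Xs (As ! j)"
    and i: "i < length As"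
  shows "mcomp M (ps ! i) [contract Xs (length As) (mcomp M u fs)] = fs ! i"
proof -
  have cods: "map (mcod M) fs = As"
    using len fs by (auto simp: mhom_def intro: nth_equalityI)
  have doms: "map (mdom M) fs = replicate (length As) Xs"
    using len fs by (auto simp: mhom_def intro: nth_equalityI)
  have fs_arr: "set fs \<subseteq> marr M"
    using len fs by (auto simp: mhom_def in_set_conv_nth)
  have p: "ps ! i \<in> mhom M [C] (As ! i)" using ps i by (simp add: projections_def)
  have ufs: "mcomp M u fs \<in> mhom M (concat (replicate (length As) Xs)) C"
    using mcomp_mhom[of u fs C] u fs_arr by (simp add: cods doms)
  have "mcomp M (ps ! i) [contract Xs (length As) (mcomp M u fs)] =
      contract Xs (length As) (mcomp M (ps ! i) [mcomp M u fs])"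
    by (rule mcomp_contract[OF p ufs Xs])
  also have "mcomp M (ps ! i) [mcomp M u fs] = mcomp M (injection As i) fs"
    using mcomp_assoc_single[of "ps ! i" u "As ! i" fs C] p u pu i fs_arr
    by (simp add: cods mhomD[OF u])
  also have "contract Xs (length As) (mcomp M (injection As i) fs) = fs ! i"
    by (rule contract_injection_mcomp[OF As i Xs len fs])
  finally show ?thesis .
qed

section \<open>Arrows out of the base obtained through the projections\<close>

lemma mcomp_projections_mhom:
  assumes "projections M As C ps" "g \<in> mhom M As B"
  shows "mcomp M g ps \<in> mhom M (replicate (length As) C) B"
  using mcomp_mhom[of g ps B] assms projectionsD[OF assms(1)] by auto

lemma contract_mcomp_projections_mhom:
  assumes "projections M As C ps" "g \<in> mhom M As B" "C \<in> mobj M"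
  shows "contract [C] (length As) (mcomp M g ps) \<in> mhom M [C] B"
proof -
  have "concat (replicate n [C]) = replicate n C" for n by (induction n) auto
  then show ?thesis
    using contract_mhom[of "mcomp M g ps" "length As" "[C]" B] mcomp_projections_mhom[OF assms(1,2)]
      assms(3) by simp
qed

text \<open>Contraction duplicates \<open>t\<close>, and associativity gives one copy to each
  projection. With \<open>g = u\<close> this recovers \<open>t\<close> from its components; with
  \<open>t = u\<close> it shows that composition with \<open>u\<close> is surjective.\<close>

lemma contract_projections_mcomp:
  assumes ps: "projections M As C ps" and g: "g \<in> mhom M As B" and t: "t \<in> mhom M Xs C"
  shows "mcomp M (contract [C] (length As) (mcomp M g ps)) [t] =
    contract Xs (length As) (mcomp M g (map (\<lambda>p. mcomp M p [t]) ps))"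
proof -
  have "mcomp M (mcomp M g ps) (replicate (length As) t) =
      mcomp M g (map (\<lambda>p. mcomp M p [t]) ps)"
    using mcomp_replicate[of g ps B t] projectionsD[OF ps] g mhomD[OF t] by simp
  then show ?thesis
    using contract_single_mcomp[OF mcomp_projections_mhom[OF ps g] t] by simp
qed

text \<open>Substituting \<open>u\<close> turns the projections into the injections, which
  contraction cancels.\<close>

lemma contract_projections_section:
  assumes As: "set As \<subseteq> mobj M"
    and ps: "projections M As C ps" and u: "u \<in> mhom M As C"
    and pu: "\<forall>i < length As. mcomp M (ps ! i) [u] = injection As i"
    and g: "g \<in> mhom M As B"
  shows "mcomp M (contract [C] (length As) (mcomp M g ps)) [u] = g"
proof -
  have "map (\<lambda>p. mcomp M p [u]) ps = map (injection As) [0..<length As]"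
    using pu projectionsD(1)[OF ps] by (auto intro: nth_equalityI)
  then show ?thesis
    using contract_projections_mcomp[OF ps g u] contract_mcomp_injections[OF As g] by simp
qed

lemma algebraic_product_iff:
  "algebraic_product M As C ps u \<longleftrightarrow>
     C \<in> mobj M \<and> projections M As C ps \<and> u \<in> mhom M As C \<and>
     contract [C] (length As) (mcomp M u ps) = mid M C \<and>
     (\<forall>i < length As. mcomp M (ps ! i) [u] = injection As i)"
  by (simp add: algebraic_product_def contract_def injection_def codiagonal_one[simplified])


section \<open>The equivalences\<close>

lemma algebraic_product_imp_universal_product:
  assumes As: "set As \<subseteq> mobj M" and alg: "algebraic_product M As C ps u"
  shows "universal_product M As C ps"
  unfolding universal_product_def
proof (intro conjI allI impI)
  have C: "C \<in> mobj M" and ps: "projections M As C ps" and u: "u \<in> mhom M As C"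
    and id: "contract [C] (length As) (mcomp M u ps) = mid M C"
    and pu: "\<forall>i < length As. mcomp M (ps ! i) [u] = injection As i"
    using alg by (auto simp: algebraic_product_iff)
  show "C \<in> mobj M" "projections M As C ps" by fact+
  fix Xs fs
  assume "set Xs \<subseteq> mobj M \<and> length fs = length As \<and>
    (\<forall>i < length As. fs ! i \<in> mhom M Xs (As ! i))"
  then have Xs: "set Xs \<subseteq> mobj M" and len: "length fs = length As"
    and fs: "\<forall>i < length As. fs ! i \<in> mhom M Xs (As ! i)" by auto
  show "\<exists>!t. t \<in> mhom M Xs C \<and> (\<forall>i < length As. mcomp M (ps ! i) [t] = fs ! i)"
  proof (rule ex1I)
    have cods: "map (mcod M) fs = As" and doms: "map (mdom M) fs = replicate (length As) Xs"
      using len fs by (auto simp: mhom_def intro: nth_equalityI)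
    have "set fs \<subseteq> marr M"
      using len fs by (auto simp: mhom_def in_set_conv_nth)
    then have "mcomp M u fs \<in> mhom M (concat (replicate (length As) Xs)) C"
      using mcomp_mhom[of u fs C] u by (simp add: cods doms)
    then have "contract Xs (length As) (mcomp M u fs) \<in> mhom M Xs C"
      using Xs by (rule contract_mhom)
    then show "contract Xs (length As) (mcomp M u fs) \<in> mhom M Xs C \<and>
        (\<forall>i < length As. mcomp M (ps ! i) [contract Xs (length As) (mcomp M u fs)] = fs ! i)"
      using mcomp_contract_section[OF Xs As ps u pu len fs] by blast
  next
    fix t
    assume t: "t \<in> mhom M Xs C \<and> (\<forall>i < length As. mcomp M (ps ! i) [t] = fs ! i)"
    then have "map (\<lambda>p. mcomp M p [t]) ps = fs"
      using len projectionsD(1)[OF ps] by (auto intro: nth_equalityI)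
    moreover have "mcomp M (mid M C) [t] = t"
      using t comp_id_left[of t] by (auto simp: mhom_def)
    \<comment> \<open>Uniqueness: \<open>t\<close> equals the identity composed with
      \<open>t\<close>; writing that identity as the contraction of \<open>mcomp M u ps\<close>
      gives the contraction of \<open>u\<close> applied to the components of \<open>t\<close>, that
      is, to \<open>fs\<close>.\<close>
    ultimately show "t = contract Xs (length As) (mcomp M u fs)"
      using contract_projections_mcomp[OF ps u conjunct1[OF t]] id by simp
  qed
qed

lemma universal_product_imp_algebraic_product:
  assumes As: "set As \<subseteq> mobj M" and univ: "universal_product M As C ps"
  shows "\<exists>u. algebraic_product M As C ps u"
proof -
  have C: "C \<in> mobj M" and ps: "projections M As C ps"
    using univ by (auto simp: universal_product_def)
  have ex1: "\<exists>!t. t \<in> mhom M Xs C \<and> (\<forall>i < length As. mcomp M (ps ! i) [t] = fs ! i)"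
    if "set Xs \<subseteq> mobj M" "length fs = length As" "\<forall>i < length As. fs ! i \<in> mhom M Xs (As ! i)"
    for Xs fs
    using univ that unfolding universal_product_def by blast
  \<comment> \<open>The arrow \<open>u\<close> is the tuple of the injections.\<close>
  have "\<exists>!t. t \<in> mhom M As C \<and>
      (\<forall>i < length As. mcomp M (ps ! i) [t] = map (injection As) [0..<length As] ! i)"
    by (rule ex1) (use As injection_mhom in auto)
  then obtain u where u: "u \<in> mhom M As C"
    and pu: "\<forall>i < length As. mcomp M (ps ! i) [u] = injection As i" by auto
  have psi: "\<forall>i < length As. ps ! i \<in> mhom M [C] (As ! i)"
    using ps by (simp add: projections_def)
  let ?t = "contract [C] (length As) (mcomp M u ps)"
  have C': "set [C] \<subseteq> mobj M" using C by simp
  \<comment> \<open>Both \<open>?t\<close> and the identity of \<open>C\<close> have the components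
    \<open>ps\<close>, so uniqueness of tuples identifies them.\<close>
  have "?t \<in> mhom M [C] C \<and> (\<forall>i < length As. mcomp M (ps ! i) [?t] = ps ! i)"
    using contract_mcomp_projections_mhom[OF ps u C]
      mcomp_contract_section[OF C' As ps u pu projectionsD(1)[OF ps] psi] by blast
  moreover have "mid M C \<in> mhom M [C] C \<and> (\<forall>i < length As. mcomp M (ps ! i) [mid M C] = ps ! i)"
  proof (intro conjI allI impI)
    fix i assume "i < length As"
    then have "ps ! i \<in> mhom M [C] (As ! i)" using psi by blast
    then show "mcomp M (ps ! i) [mid M C] = ps ! i"
      using comp_id_right[of "ps ! i"] by (simp add: mhom_def)
  qed (rule id_hom[OF C])
  ultimately have "?t = mid M C"
    using ex1[OF C' projectionsD(1)[OF ps] psi] by blast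
  then show ?thesis using C ps u pu by (auto simp: algebraic_product_iff)
qed

lemma algebraic_product_imp_preuniversal:
  assumes As: "set As \<subseteq> mobj M" and alg: "algebraic_product M As C ps u"
  shows "preuniversal M u"
proof -
  have C: "C \<in> mobj M" and ps: "projections M As C ps" and u: "u \<in> mhom M As C"
    and id: "contract [C] (length As) (mcomp M u ps) = mid M C"
    and pu: "\<forall>i < length As. mcomp M (ps ! i) [u] = injection As i"
    using alg by (auto simp: algebraic_product_iff)
  have "bij_betw (\<lambda>f. mcomp M f [u]) (mhom M [C] B) (mhom M As B)" for B
  proof (rule bij_betw_byWitness[where f' = "\<lambda>g. contract [C] (length As) (mcomp M g ps)"])
    show "\<forall>f \<in> mhom M [C] B. contract [C] (length As) (mcomp M (mcomp M f [u]) ps) = f"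
    proof
      fix f assume f: "f \<in> mhom M [C] B"
      have "concat (replicate n [C]) = replicate n C" for n by (induction n) auto
      then have ups: "mcomp M u ps \<in> mhom M (concat (replicate (length As) [C])) C"
        using mcomp_projections_mhom[OF ps u] by simp
      have "mcomp M (mcomp M f [u]) ps = mcomp M f [mcomp M u ps]"
        using mcomp_assoc_single[of f u B ps C] f u projectionsD[OF ps] mhomD[OF u] by auto
      \<comment> \<open>Contraction passes inside \<open>f\<close>, where it meets
        \<open>mcomp M u ps\<close> and yields the identity.\<close>
      then have "contract [C] (length As) (mcomp M (mcomp M f [u]) ps) = mcomp M f [mid M C]"
        using mcomp_contract[OF f ups] C id by simp
      also have "\<dots> = f" using comp_id_right[of f] mhomD[OF f] by simp
      finally show "contract [C] (length As) (mcomp M (mcomp M f [u]) ps) = f" .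
    qed
    show "\<forall>g \<in> mhom M As B. mcomp M (contract [C] (length As) (mcomp M g ps)) [u] = g"
      using contract_projections_section[OF As ps u pu] by blast
    show "(\<lambda>f. mcomp M f [u]) ` mhom M [C] B \<subseteq> mhom M As B"
      using mcomp_mhom_single[OF _ u] by blast
    show "(\<lambda>g. contract [C] (length As) (mcomp M g ps)) ` mhom M As B \<subseteq> mhom M [C] B"
      using contract_mcomp_projections_mhom[OF ps _ C] by blast
  qed
  then show ?thesis by (simp add: preuniversal_def mhomD[OF u])
qed

lemma preuniversal_imp_algebraic_product:
  assumes pre: "preuniversal M u"
  shows "\<exists>ps. algebraic_product M (mdom M u) (mcod M u) ps u"
proof -
  define As C where "As = mdom M u" and "C = mcod M u"
  have arr: "u \<in> marr M" using pre by (simp add: preuniversal_def)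
  then have u: "u \<in> mhom M As C" by (simp add: mhom_def As_def C_def)
  have As: "set As \<subseteq> mobj M" and C: "C \<in> mobj M"
    using dom_obj[OF arr] cod_obj[OF arr] by (auto simp: As_def C_def)
  have bij: "bij_betw (\<lambda>f. mcomp M f [u]) (mhom M [C] B) (mhom M As B)" if "B \<in> mobj M" for B
    using pre that by (simp add: preuniversal_def As_def C_def)
  \<comment> \<open>Surjectivity of composition with \<open>u\<close> at \<open>B = As ! i\<close>
    supplies each projection as a preimage of an injection.\<close>
  have "\<exists>p. p \<in> mhom M [C] (As ! i) \<and> mcomp M p [u] = injection As i" if "i < length As" for i
  proof -
    have "As ! i \<in> mobj M" using that As by auto
    from bij_betw_imp_surj_on[OF bij[OF this]] injection_mhom[OF As that]
    show ?thesis by (metis imageE)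
  qed
  then obtain p where p: "p i \<in> mhom M [C] (As ! i) \<and> mcomp M (p i) [u] = injection As i"
    if "i < length As" for i by metis
  define ps where "ps = map p [0..<length As]"
  have ps: "projections M As C ps" and pu: "\<forall>i < length As. mcomp M (ps ! i) [u] = injection As i"
    using p by (auto simp: projections_def ps_def)
  \<comment> \<open>Both sides equal \<open>u\<close>, so injectivity of composition with
    \<open>u\<close> at \<open>B = C\<close> cancels it.\<close>
  have "mcomp M (contract [C] (length As) (mcomp M u ps)) [u] = mcomp M (mid M C) [u]"
    using contract_projections_section[OF As ps u pu u] comp_id_left[OF arr] by (simp add: C_def)
  then have "contract [C] (length As) (mcomp M u ps) = mid M C"
    by (rule inj_onD[OF bij_betw_imp_inj_on[OF bij[OF C]]])
      (use contract_mcomp_projections_mhom[OF ps u C] id_hom[OF C] in auto)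
  then show ?thesis using C ps u pu
    by (auto simp: algebraic_product_iff simp flip: As_def C_def)
qed

end

theorem proposition4p5:
  fixes M :: "('o, 'a, 'z) cartesian_multicategory_scheme"
    and As :: "'o list"
  assumes "cartesian_multicategory M"
    and "set As \<subseteq> mobj M"
  shows "((\<exists>C ps u. algebraic_product M As C ps u) \<longleftrightarrow> (\<exists>C ps. universal_product M As C ps)) \<and>
         ((\<exists>C ps. universal_product M As C ps) \<longleftrightarrow> (\<exists>u. preuniversal M u \<and> mdom M u = As))"
proof -
  interpret cartesian_multicategory M by fact
  \<comment> \<open>Both equivalences pass through algebraic products, whose arrow \<open>u\<close>
    is the preuniversal one; this fact supplies its domain.\<close>
  have "mdom M u = As" if "algebraic_product M As C ps u" for C ps u
    using that by (auto simp: algebraic_product_def mhom_def)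
  then show ?thesis
    using algebraic_product_imp_universal_product universal_product_imp_algebraic_product
      algebraic_product_imp_preuniversal preuniversal_imp_algebraic_product assms(2)
    by metis
qed

end
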